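(* Let $\varphi$ be a Boolean formula over the finite set of Boolean variables $\Sigma$, let $\ell_1,\ldots,\ell_n$ be literals of variables in $\Sigma$ (possibly including complementary literals), let $\omega$ be a world and let $\alpha=\omega\cap\{\bar{\ell}_1,\ldots,\bar{\ell}_n\}$. Then $\omega\models\forall \ell_1,\ldots,\ell_n\cdot\varphi$ if and only if $\omega$ is an $\alpha$-independent model of $\varphi$.
   Context: $\Sigma$ is a fixed finite set of Boolean variables. A literal of variable $X$ is $x$ (positive) or $\bar{x}$ (negative); $\bar{\ell}$ denotes the complement of literal $\ell$. A world $\omega$ is a truth assignment to $\Sigma$, identified with the set of literals (exactly one per variable) that it makes true. A consistent set of literals (a term) is read as the conjunction of its literals (the empty one being true), and $\models$ denotes logical consequence. Conditioning: $\varphi|x$ (resp. $\varphi|\bar{x}$) is obtained by replacing every occurrence of variable $X$ in $\varphi$ with true (resp. false). Universal literal quantification is defined by $\forall \ell\cdot\varphi = (\ell\vee(\varphi|\bar{\ell}))\wedge(\varphi|\ell)$, and $\forall \ell_1,\ldots,\ell_n\cdot\varphi$ denotes the result of applying $\forall\ell_1,\ldots,\forall\ell_n$ successively (the order does not matter up to logical equivalence). For a set of literals $\alpha$, a world $\omega$ is an $\alpha$-independent model of $\varphi$ iff $\alpha\subseteq\omega$ and $\omega\setminus\alpha\models\varphi$. *)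

theory Defs
  imports Main
begin

datatype 'v literal = Pos (var: 'v) | Neg (var: 'v)

fun compl :: "'v literal \<Rightarrow> 'v literal" where
  "compl (Pos X) = Neg X"
| "compl (Neg X) = Pos X"

datatype (vars: 'v) formula =
    FTrue
  | FFalse
  | FVar 'v
  | FNot "'v formula"
  | FAnd "'v formula" "'v formula"
  | FOr "'v formula" "'v formula"
  | FImp "'v formula" "'v formula"
  | FIff "'v formula" "'v formula"

fun lit :: "'v literal \<Rightarrow> 'v formula" where
  "lit (Pos X) = FVar X"
| "lit (Neg X) = FNot (FVar X)"

text \<open>A truth assignment to \<open>\<Sigma>\<close> is represented by the set of literals it makes true.\<close>

definition world :: "'v set \<Rightarrow> 'v literal set \<Rightarrow> bool" where
  "world \<Sigma> \<omega> \<longleftrightarrow> var ` \<omega> \<subseteq> \<Sigma> \<and> (\<forall>X\<in>\<Sigma>. Neg X \<in> \<omega> \<longleftrightarrow> Pos X \<notin> \<omega>)"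

text \<open>Truth of a formula at a world; meant for worlds over a set containing the variables of
  the formula.\<close>

primrec sat :: "'v literal set \<Rightarrow> 'v formula \<Rightarrow> bool" where
  "sat \<omega> FTrue \<longleftrightarrow> True"
| "sat \<omega> FFalse \<longleftrightarrow> False"
| "sat \<omega> (FVar X) \<longleftrightarrow> Pos X \<in> \<omega>"
| "sat \<omega> (FNot \<phi>) \<longleftrightarrow> \<not> sat \<omega> \<phi>"
| "sat \<omega> (FAnd \<phi> \<psi>) \<longleftrightarrow> sat \<omega> \<phi> \<and> sat \<omega> \<psi>"
| "sat \<omega> (FOr \<phi> \<psi>) \<longleftrightarrow> sat \<omega> \<phi> \<or> sat \<omega> \<psi>"
| "sat \<omega> (FImp \<phi> \<psi>) \<longleftrightarrow> (sat \<omega> \<phi> \<longrightarrow> sat \<omega> \<psi>)"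
| "sat \<omega> (FIff \<phi> \<psi>) \<longleftrightarrow> (sat \<omega> \<phi> \<longleftrightarrow> sat \<omega> \<psi>)"

text \<open>Logical consequence of a term, i.e. of a set of literals read as their conjunction.\<close>

definition term_entails :: "'v set \<Rightarrow> 'v literal set \<Rightarrow> 'v formula \<Rightarrow> bool" where
  "term_entails \<Sigma> \<tau> \<phi> \<longleftrightarrow> (\<forall>\<omega>. world \<Sigma> \<omega> \<and> (\<forall>l\<in>\<tau>. sat \<omega> (lit l)) \<longrightarrow> sat \<omega> \<phi>)"

primrec subst_var :: "'v \<Rightarrow> 'v formula \<Rightarrow> 'v formula \<Rightarrow> 'v formula" where
  "subst_var X \<chi> FTrue = FTrue"
| "subst_var X \<chi> FFalse = FFalse"
| "subst_var X \<chi> (FVar Y) = (if Y = X then \<chi> else FVar Y)"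
| "subst_var X \<chi> (FNot \<phi>) = FNot (subst_var X \<chi> \<phi>)"
| "subst_var X \<chi> (FAnd \<phi> \<psi>) = FAnd (subst_var X \<chi> \<phi>) (subst_var X \<chi> \<psi>)"
| "subst_var X \<chi> (FOr \<phi> \<psi>) = FOr (subst_var X \<chi> \<phi>) (subst_var X \<chi> \<psi>)"
| "subst_var X \<chi> (FImp \<phi> \<psi>) = FImp (subst_var X \<chi> \<phi>) (subst_var X \<chi> \<psi>)"
| "subst_var X \<chi> (FIff \<phi> \<psi>) = FIff (subst_var X \<chi> \<phi>) (subst_var X \<chi> \<psi>)"

fun condition :: "'v formula \<Rightarrow> 'v literal \<Rightarrow> 'v formula" where
  "condition \<phi> (Pos X) = subst_var X FTrue \<phi>"
| "condition \<phi> (Neg X) = subst_var X FFalse \<phi>"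

definition forall_lit :: "'v literal \<Rightarrow> 'v formula \<Rightarrow> 'v formula" where
  "forall_lit l \<phi> = FAnd (FOr (lit l) (condition \<phi> (compl l))) (condition \<phi> l)"

text \<open>The first literal of the list is the outermost quantifier; up to logical equivalence the
  order is irrelevant.\<close>

definition forall_lits :: "'v literal list \<Rightarrow> 'v formula \<Rightarrow> 'v formula" where
  "forall_lits ls \<phi> = foldr forall_lit ls \<phi>"

definition independent_model ::
    "'v set \<Rightarrow> 'v literal set \<Rightarrow> 'v literal set \<Rightarrow> 'v formula \<Rightarrow> bool" where
  "independent_model \<Sigma> \<alpha> \<omega> \<phi> \<longleftrightarrow> \<alpha> \<subseteq> \<omega> \<and> term_entails \<Sigma> (\<omega> - \<alpha>) \<phi>"

text \<open>Sanity check: for a world, truth of a formula over \<open>\<Sigma>\<close> coincides with logical consequence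
  of the world read as a term.\<close>

lemma world_sat_lit:
  assumes "world \<Sigma> \<omega>" "var l \<in> \<Sigma>"
  shows "sat \<omega> (lit l) \<longleftrightarrow> l \<in> \<omega>"
  using assms by (cases l) (auto simp: world_def)

lemma world_subset_eq:
  assumes "world \<Sigma> \<omega>" "world \<Sigma> \<omega>'" "\<omega> \<subseteq> \<omega>'"
  shows "\<omega> = \<omega>'"
proof -
  have "l \<in> \<omega>" if "l \<in> \<omega>'" for l
  proof -
    have "var l \<in> \<Sigma>" using assms(2) that by (auto simp: world_def)
    then show ?thesis using assms that unfolding world_def by (cases l) auto
  qed
  then show ?thesis using assms(3) by blast
qed

lemma world_sat_iff_term_entails:
  assumes "world \<Sigma> \<omega>"
  shows "sat \<omega> \<phi> \<longleftrightarrow> term_entails \<Sigma> \<omega> \<phi>"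
proof -
  have vars: "var l \<in> \<Sigma>" if "l \<in> \<omega>" for l
    using assms that by (auto simp: world_def)
  have "\<omega>' = \<omega>" if "world \<Sigma> \<omega>'" "\<forall>l\<in>\<omega>. sat \<omega>' (lit l)" for \<omega>'
    using world_subset_eq[OF assms that(1)] world_sat_lit[OF that(1) vars] that(2) by blast
  moreover have "\<forall>l\<in>\<omega>. sat \<omega> (lit l)"
    using world_sat_lit[OF assms vars] by blast
  ultimately show ?thesis using assms unfolding term_entails_def by blast
qed

end

theory Submission
  imports Defs
begin

text \<open>Let \<open>\<omega>[l]\<close> be the world \<open>\<omega>\<close> with the variable of \<open>l\<close> reset so that \<open>l\<close> holds. Then
  \<open>\<omega>\<close> satisfies \<open>\<forall>l\<cdot>\<psi>\<close> iff \<open>\<omega>\<close> satisfies \<open>\<psi>\<close> and, in case \<open>\<omega>\<close> contains the complement of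
  \<open>l\<close>, so does \<open>\<omega>[l]\<close>. Hence every quantified literal that is false in \<open>\<omega>\<close> frees its variable,
  and by induction \<open>\<omega>\<close> satisfies \<open>\<forall>l\<^sub>1,\<dots>,l\<^sub>n\<cdot>\<phi>\<close> iff all worlds that contain \<open>\<omega>\<close> minus the
  complements of the \<open>l\<^sub>i\<close> satisfy \<open>\<phi>\<close>.\<close>

definition set_lit :: "'v literal \<Rightarrow> 'v literal set \<Rightarrow> 'v literal set" where
  "set_lit l \<omega> = insert l (\<omega> - {compl l})"

text \<open>Semantic counterpart of the substitution: evaluation inspects only positive literals,
  and \<open>set_lit\<close> fixes the one of the substituted variable.\<close>

lemma sat_condition: "sat \<omega> (condition \<phi> l) \<longleftrightarrow> sat (set_lit l \<omega>) \<phi>"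
proof (cases l)
  case (Pos X)
  have "sat \<omega> (subst_var X FTrue \<phi>) \<longleftrightarrow> sat (insert (Pos X) (\<omega> - {Neg X})) \<phi>"
    by (induction \<phi>) auto
  then show ?thesis by (simp add: Pos set_lit_def)
next
  case (Neg X)
  have "sat \<omega> (subst_var X FFalse \<phi>) \<longleftrightarrow> sat (insert (Neg X) (\<omega> - {Pos X})) \<phi>"
    by (induction \<phi>) auto
  then show ?thesis by (simp add: Neg set_lit_def)
qed

lemma compl_mem_world_iff:
  assumes "world \<Sigma> \<omega>" "var l \<in> \<Sigma>"
  shows "compl l \<in> \<omega> \<longleftrightarrow> l \<notin> \<omega>"
  using assms by (cases l) (auto simp: world_def)

lemma world_set_lit:
  assumes "world \<Sigma> \<omega>" "var l \<in> \<Sigma>"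
  shows "world \<Sigma> (set_lit l \<omega>)"
  using assms by (cases l) (auto simp: world_def set_lit_def)

lemma compl_compl [simp]: "compl (compl l) = l"
  by (cases l) auto

lemma var_compl [simp]: "var (compl l) = var l"
  by (cases l) auto

lemma set_lit_idem:
  assumes "world \<Sigma> \<omega>" "l \<in> \<omega>" "var l \<in> \<Sigma>"
  shows "set_lit l \<omega> = \<omega>"
  using compl_mem_world_iff[OF assms(1,3)] assms(2) by (auto simp: set_lit_def)

lemma sat_forall_lit:
  assumes "world \<Sigma> \<omega>" "var l \<in> \<Sigma>"
  shows "sat \<omega> (forall_lit l \<phi>) \<longleftrightarrow> sat \<omega> \<phi> \<and> (compl l \<in> \<omega> \<longrightarrow> sat (set_lit l \<omega>) \<phi>)"
proof (cases "l \<in> \<omega>")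
  case True
  then show ?thesis
    using assms by (simp add: forall_lit_def sat_condition world_sat_lit set_lit_idem
        compl_mem_world_iff)
next
  case False
  then have "compl l \<in> \<omega>" using assms by (simp add: compl_mem_world_iff)
  \<comment> \<open>The disjunct \<open>condition \<phi> (compl l)\<close> is thus evaluated at
    \<open>\<omega>\<close> itself.\<close>
  then have "set_lit (compl l) \<omega> = \<omega>" using assms by (simp add: set_lit_idem)
  then show ?thesis
    using assms False \<open>compl l \<in> \<omega>\<close> by (simp add: forall_lit_def sat_condition world_sat_lit)
qed

text \<open>Over \<open>\<Sigma>\<close>, truth of a literal at a world is membership. Outside
  \<open>\<Sigma>\<close> this fails: \<open>Neg X\<close> is then true without being a
  member.\<close>

lemma term_entails_iff_superset:
  assumes "var ` \<tau> \<subseteq> \<Sigma>"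
  shows "term_entails \<Sigma> \<tau> \<phi> \<longleftrightarrow> (\<forall>\<omega>. world \<Sigma> \<omega> \<and> \<tau> \<subseteq> \<omega> \<longrightarrow> sat \<omega> \<phi>)"
proof -
  have "(\<forall>l\<in>\<tau>. sat \<omega> (lit l)) \<longleftrightarrow> \<tau> \<subseteq> \<omega>" if "world \<Sigma> \<omega>" for \<omega>
    using assms world_sat_lit[OF that] by blast
  then show ?thesis unfolding term_entails_def by blast
qed

lemma sat_forall_lits:
  assumes "world \<Sigma> \<omega>" "\<And>l. l \<in> set ls \<Longrightarrow> var l \<in> \<Sigma>"
  shows "sat \<omega> (forall_lits ls \<phi>) \<longleftrightarrow>
    (\<forall>\<omega>'. world \<Sigma> \<omega>' \<and> \<omega> - compl ` set ls \<subseteq> \<omega>' \<longrightarrow> sat \<omega>' \<phi>)"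
  using assms
\<comment> \<open>The induction hypothesis is applied at both \<open>\<omega>\<close> and
  \<open>set_lit l \<omega>\<close>.\<close>
proof (induction ls arbitrary: \<omega>)
  case Nil
  then show ?case using world_subset_eq by (auto simp: forall_lits_def)
next
  case (Cons l ls)
  have l: "var l \<in> \<Sigma>" using Cons.prems(2) by simp
  have IH: "sat \<nu> (forall_lits ls \<phi>) \<longleftrightarrow>
      (\<forall>\<omega>'. world \<Sigma> \<omega>' \<and> \<nu> - compl ` set ls \<subseteq> \<omega>' \<longrightarrow> sat \<omega>' \<phi>)"
    if "world \<Sigma> \<nu>" for \<nu>
    using Cons.IH[OF that] Cons.prems(2) by simp
  \<comment> \<open>If \<open>compl l\<close> is in \<open>\<omega>\<close>, the world
    \<open>\<omega>'\<close> contains either \<open>compl l\<close>, giving the first disjunct, or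
    \<open>l\<close>, giving the second.\<close>
  have split: "\<omega> - compl ` set (l # ls) \<subseteq> \<omega>' \<longleftrightarrow> \<omega> - compl ` set ls \<subseteq> \<omega>' \<or>
      compl l \<in> \<omega> \<and> set_lit l \<omega> - compl ` set ls \<subseteq> \<omega>'" if "world \<Sigma> \<omega>'" for \<omega>'
    using compl_mem_world_iff[OF that l] by (auto simp: set_lit_def)
  have "sat \<omega> (forall_lits (l # ls) \<phi>) \<longleftrightarrow> sat \<omega> (forall_lits ls \<phi>) \<and>
      (compl l \<in> \<omega> \<longrightarrow> sat (set_lit l \<omega>) (forall_lits ls \<phi>))"
    using sat_forall_lit[OF Cons.prems(1) l] by (simp add: forall_lits_def)
  then show ?case
    unfolding IH[OF Cons.prems(1)] IH[OF world_set_lit[OF Cons.prems(1) l]]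
    using split by blast
qed

theorem theorem4:
  fixes \<Sigma> :: "'v set"
    and \<phi> :: "'v formula"
    and ls :: "'v literal list"
    and \<omega> \<alpha> :: "'v literal set"
  assumes "finite \<Sigma>"
    and "vars \<phi> \<subseteq> \<Sigma>"
    and "\<And>l. l \<in> set ls \<Longrightarrow> var l \<in> \<Sigma>"
    and "world \<Sigma> \<omega>"
    and "\<alpha> = \<omega> \<inter> compl ` set ls"
  shows "sat \<omega> (forall_lits ls \<phi>) \<longleftrightarrow> independent_model \<Sigma> \<alpha> \<omega> \<phi>"
proof -
  have "\<omega> - \<alpha> = \<omega> - compl ` set ls" using assms(5) by blast
  moreover have "var ` (\<omega> - \<alpha>) \<subseteq> \<Sigma>" using assms(4) by (auto simp: world_def)
  ultimately show ?thesis
    using assms(5) sat_forall_lits[OF assms(4,3)]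
    by (simp add: independent_model_def term_entails_iff_superset)
qed

end
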